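(* Let $(M,\mathcal{M},\mu)$ be a $\sigma$-finite measure space, let $\mathfrak{Z}$ and $\mathfrak{G}$ be $\mathbb{F}$-Fréchet spaces, and let $\psi:M\to\mathfrak{Z}'$ be $\mathfrak{Z}'$-Gelfand $\mu$-integrable. Let $$T:(\mathfrak{Z}',\sigma(\mathfrak{Z}',\mathfrak{Z}))\to(\mathfrak{G}',\sigma(\mathfrak{G}',\mathfrak{G}))$$ be linear and continuous. Then $T\psi$ is $\mathfrak{G}'$-Gelfand $\mu$-integrable and, for any $E\in\mathcal{M}$, $$T\int_E\psi(x)\,\mu(dx)=\int_E T\psi(x)\,\mu(dx)$$ in $\mathfrak{G}'$.
   Context: $\mathbb{F}\in\{\mathbb{R},\mathbb{C}\}$. A Fréchet space is a metrizable, complete, locally convex topological vector space over $\mathbb{F}$; $\mathfrak{Z}'$ is its topological dual and $\langle z',z\rangle$ the dual pairing of $z'\in\mathfrak{Z}'$, $z\in\mathfrak{Z}$. $\sigma(\mathfrak{Z}',\mathfrak{Z})$ is the weak star topology on $\mathfrak{Z}'$, i.e. the coarsest topology making all maps $z'\mapsto\langle z',z\rangle$, $z\in\mathfrak{Z}$, continuous. A map $\psi:M\to\mathfrak{Z}'$ is $\mathfrak{Z}'$-Gelfand $\mu$-integrable if $x\mapsto\langle\psi(x),z\rangle$ belongs to $L^1(\mu)$ for every $z\in\mathfrak{Z}$. For such $\psi$ and $E\in\mathcal{M}$, the Gelfand integral $\int_E\psi(x)\,\mu(dx)$ is the element of $\mathfrak{Z}'$ given by $z\mapsto\int_E\langle\psi(x),z\rangle\,\mu(dx)$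 (this functional is continuous). The same definitions apply with $\mathfrak{G}$ in place of $\mathfrak{Z}$. $T\psi$ denotes the map $x\mapsto T(\psi(x))$. *)

theory Defs
  imports "HOL-Analysis.Analysis"
begin

text \<open>
  The scalar field: up to an isometric isomorphism of normed fields, \<open>real\<close> and \<open>complex\<close> are the
  only members of this class. The superclass \<open>euclidean_space\<close> only serves to make the Bochner
  integral available for scalar-valued functions.
\<close>

class real_or_complex = real_normed_field + euclidean_space +
  assumes real_or_complex:
    "(\<forall>x. \<exists>a. x = a *\<^sub>R 1) \<or>
     (\<exists>i. i * i = - 1 \<and> (\<forall>x. \<exists>a b. x = a *\<^sub>R 1 + b *\<^sub>R i))"

instance real :: real_or_complex
  by standard auto

instance complex :: real_or_complex
proof
  have "x = Re x *\<^sub>R 1 + Im x *\<^sub>R \<i>" for x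
    by (simp add: complex_eq_iff)
  then show "(\<forall>x::complex. \<exists>a. x = a *\<^sub>R 1) \<or>
     (\<exists>i::complex. i * i = - 1 \<and> (\<forall>x. \<exists>a b. x = a *\<^sub>R 1 + b *\<^sub>R i))"
    by (intro disjI2 exI[of _ \<i>]) auto
qed

text \<open>
  A type class cannot depend on the scalar field, so the scalar multiplication is a locale parameter;
  continuity of addition and negation comes from the class \<open>topological_ab_group_add\<close>.
\<close>

locale topological_vector_space = vector_space smul
  for smul :: "'f::real_or_complex \<Rightarrow> 'z::topological_ab_group_add \<Rightarrow> 'z" +
  assumes continuous_smul: "continuous_on UNIV (\<lambda>(c, z). smul c z)"

definition tvs_convex :: "('f::real_or_complex \<Rightarrow> 'z::topological_ab_group_add \<Rightarrow> 'z) \<Rightarrow> 'z set \<Rightarrow> bool"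
  where "tvs_convex smul C \<longleftrightarrow>
    (\<forall>x\<in>C. \<forall>y\<in>C. \<forall>t::real. 0 \<le> t \<longrightarrow> t \<le> 1 \<longrightarrow>
      smul (of_real t) x + smul (of_real (1 - t)) y \<in> C)"

text \<open>
  Completeness is that of the uniform structure given by translating the neighbourhoods of \<open>0\<close>:
  a proper filter is Cauchy iff differences of its points tend to \<open>0\<close>, and every Cauchy filter
  converges.
\<close>

locale frechet_space = topological_vector_space smul
  for smul :: "'f::real_or_complex \<Rightarrow> 'z::topological_ab_group_add \<Rightarrow> 'z" +
  assumes metrizable: "metrizable_space (euclidean :: 'z topology)"
    and complete: "\<And>F :: 'z filter. F \<noteq> bot \<Longrightarrow>
          filterlim (\<lambda>(x, y). x - y) (nhds 0) (F \<times>\<^sub>F F) \<Longrightarrow> \<exists>z. F \<le> nhds z"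
    and locally_convex: "\<And>U :: 'z set. open U \<Longrightarrow> 0 \<in> U \<Longrightarrow>
          \<exists>C. C \<subseteq> U \<and> 0 \<in> interior C \<and> tvs_convex smul C"

text \<open>
  Elements of the topological dual are functions, and the dual pairing is function application.
  Vector space operations on the dual are pointwise.
\<close>

definition tvs_dual :: "('f::real_or_complex \<Rightarrow> 'z::topological_ab_group_add \<Rightarrow> 'z) \<Rightarrow> ('z \<Rightarrow> 'f) set"
  where "tvs_dual smul = {u. Vector_Spaces.linear smul (*) u \<and> continuous_on UNIV u}"

definition weak_star :: "('f::real_or_complex \<Rightarrow> 'z::topological_ab_group_add \<Rightarrow> 'z) \<Rightarrow> ('z \<Rightarrow> 'f) topology"
  where "weak_star smul =
    topology_generated_by {{u \<in> tvs_dual smul. u z \<in> V} | z V. open V}"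

lemma topspace_weak_star: "topspace (weak_star smul) = tvs_dual smul"
  unfolding weak_star_def topology_generated_by_topspace by (auto intro!: exI[of _ UNIV])

definition dual_linear ::
    "('f::real_or_complex \<Rightarrow> 'z::topological_ab_group_add \<Rightarrow> 'z) \<Rightarrow>
     ('f \<Rightarrow> 'g::topological_ab_group_add \<Rightarrow> 'g) \<Rightarrow> (('z \<Rightarrow> 'f) \<Rightarrow> ('g \<Rightarrow> 'f)) \<Rightarrow> bool"
  where "dual_linear smulZ smulG T \<longleftrightarrow>
    T ` tvs_dual smulZ \<subseteq> tvs_dual smulG \<and>
    (\<forall>u\<in>tvs_dual smulZ. \<forall>v\<in>tvs_dual smulZ. T (\<lambda>z. u z + v z) = (\<lambda>g. T u g + T v g)) \<and>
    (\<forall>c. \<forall>u\<in>tvs_dual smulZ. T (\<lambda>z. c * u z) = (\<lambda>g. c * T u g))"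

definition gelfand_integrable ::
    "('f::real_or_complex \<Rightarrow> 'z::topological_ab_group_add \<Rightarrow> 'z) \<Rightarrow> 'm measure \<Rightarrow> ('m \<Rightarrow> 'z \<Rightarrow> 'f) \<Rightarrow> bool"
  where "gelfand_integrable smul M \<psi> \<longleftrightarrow>
    (\<forall>x\<in>space M. \<psi> x \<in> tvs_dual smul) \<and> (\<forall>z. integrable M (\<lambda>x. \<psi> x z))"

text \<open>
  For a Gelfand integrable function on a Frechet space this functional is continuous, so it is an
  element of the dual.
\<close>

definition gelfand_integral :: "'m measure \<Rightarrow> 'm set \<Rightarrow> ('m \<Rightarrow> 'z \<Rightarrow> 'f::real_or_complex) \<Rightarrow> 'z \<Rightarrow> 'f"
  where "gelfand_integral M E \<psi> = (\<lambda>z. LINT x:E|M. \<psi> x z)"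

end

theory Submission
  imports Defs
begin

text \<open>
  Two facts carry the proof.

  Weak star continuous linear functionals on the dual are evaluations
  (\<open>weak_star_continuous_functional_is_evaluation\<close>). For each \<open>g\<close> the functional \<open>u \<mapsto> T u g\<close> is of
  this kind, so there is \<open>z\<close> with \<open>T u g = u z\<close> for all \<open>u\<close> in the dual. Integrability of
  \<open>x \<mapsto> T (\<psi> x) g = \<psi> x z\<close> is then immediate, and evaluating \<open>T\<close> at the Gelfand integral of \<open>\<psi>\<close> gives
  the integral of \<open>\<psi> x z\<close> over \<open>E\<close>, which is the claimed identity.

  This argument needs the Gelfand integral to lie in the dual, i.e. to be a continuous functional
  (\<open>gelfand_integral_in_dual\<close>). The seminorm \<open>p z = \<integral> norm (\<psi> x z) d\<mu>\<close> is finite everywhere, and its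
  sublevel sets are closed by Fatou's lemma. Those of integer level
  cover the space, so by Baire's theorem
  (\<open>complete_group_Baire\<close>) one of them has an interior point; the triangle inequality moves that point
  to the origin, so \<open>p\<close>, which dominates the integral over every \<open>E\<close>, is bounded near \<open>0\<close>.
\<close>

section \<open>Baire's theorem for complete metrizable groups\<close>

text \<open>
  Completeness is that of the uniform structure of the group and not that of a metric inducing the
  topology: such a metric need not be translation invariant.
\<close>

lemma complete_group_Baire:
  fixes A :: "nat \<Rightarrow> 'z::topological_ab_group_add set"
  assumes metrizable: "metrizable_space (euclidean :: 'z topology)"
    and complete: "\<And>F :: 'z filter. F \<noteq> bot \<Longrightarrow>
          filterlim (\<lambda>(x, y). x - y) (nhds 0) (F \<times>\<^sub>F F) \<Longrightarrow> \<exists>z. F \<le> nhds z"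
    and closed: "\<And>n. closed (A n)"
    and cover: "(\<Union>n. A n) = UNIV"
  shows "\<exists>n. interior (A n) \<noteq> {}"
proof (rule ccontr)
  assume "\<not> ?thesis"
  then have int: "interior (A n) = {}" for n by blast
  obtain \<B> :: "'z set set" where \<B>: "countable \<B>" "\<And>V. V \<in> \<B> \<Longrightarrow> open V"
    "\<And>U. open U \<Longrightarrow> 0 \<in> U \<Longrightarrow> \<exists>V\<in>\<B>. 0 \<in> V \<and> V \<subseteq> U"
    using metrizable_imp_first_countable[OF metrizable]
    unfolding first_countable_def by (metis UNIV_I open_openin topspace_euclidean)
  define \<B>0 where "\<B>0 = {V\<in>\<B>. 0 \<in> V}"
  have \<B>0: "countable \<B>0" "\<B>0 \<noteq> {}"
    using \<B>(1) \<B>(3)[of UNIV] by (auto simp: \<B>0_def)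
  define U where "U = from_nat_into \<B>0"
  have "U n \<in> \<B>0" for n using \<B>0 by (simp add: U_def from_nat_into)
  then have U: "open (U n)" "0 \<in> U n" for n using \<B>(2) by (auto simp: \<B>0_def)
  have U_base: "\<exists>n. U n \<subseteq> W" if "open W" "0 \<in> W" for W
    using \<B>(3)[OF that] \<B>0 unfolding U_def
    by (metis (mono_tags, lifting) \<B>0_def from_nat_into_surj mem_Collect_eq)
  \<comment> \<open>Stage \<open>n\<close> picks a nonempty open \<open>W\<close> inside a closed \<open>C\<close>; the next closed set lies in \<open>W\<close>,
     misses \<open>A n\<close> and is small of order \<open>U n\<close>.\<close>
  define P where "P = (\<lambda>(n::nat) (W :: 'z set, C). open W \<and> W \<noteq> {} \<and> W \<subseteq> C \<and> closed C)"
  define Q where "Q = (\<lambda>(n::nat) (W :: 'z set, C :: 'z set) (W' :: 'z set, C').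
    C' \<subseteq> W \<and> C' \<inter> A n = {} \<and> (\<forall>x\<in>C'. \<forall>y\<in>C'. x - y \<in> U n))"
  have step: "\<exists>s'. P (Suc n) s' \<and> Q n s s'" if "P n s" for n and s :: "'z set \<times> 'z set"
  proof -
    obtain W C where s: "s = (W, C)" by force
    have W: "open W" "W \<noteq> {}" using that by (auto simp: P_def s)
    have "\<not> W \<subseteq> A n" using interior_maximal[OF _ W(1), of "A n"] int W by auto
    then obtain x where x: "x \<in> W" "x \<notin> A n" by blast
    have "((\<lambda>p. fst p - snd p) \<longlongrightarrow> x - x) (nhds x \<times>\<^sub>F nhds x)"
      by (intro tendsto_diff filterlim_fst filterlim_snd)
    then have "eventually (\<lambda>p. fst p - snd p \<in> U n) (nhds x \<times>\<^sub>F nhds x)"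
      using U[of n] by (auto simp: tendsto_def)
    then obtain Pf Pg where Pfg: "eventually Pf (nhds x)" "eventually Pg (nhds x)"
        "\<And>a b. Pf a \<Longrightarrow> Pg b \<Longrightarrow> a - b \<in> U n"
      unfolding eventually_prod_filter by auto
    then have "eventually (\<lambda>a. Pf a \<and> Pg a) (nhds x)" by (simp add: eventually_conj_iff)
    then obtain N where N: "open N" "x \<in> N" "\<And>a b. a \<in> N \<Longrightarrow> b \<in> N \<Longrightarrow> a - b \<in> U n"
      using Pfg(3) unfolding eventually_nhds by metis
    have "open (N \<inter> (W - A n))" using N W closed by (intro open_Int open_Diff)
    moreover have "x \<in> N \<inter> (W - A n)" using N x by blast
    ultimately obtain W' C' where "open W'" "closed C'" "x \<in> W'" "W' \<subseteq> C'" "C' \<subseteq> N \<inter> (W - A n)"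
      using metrizable_imp_regular_space[OF metrizable]
      unfolding neighbourhood_base_of_closedin[symmetric] neighbourhood_base_of
      by (metis closed_closedin open_openin)
    then have "P (Suc n) (W', C') \<and> Q n s (W', C')"
      using N by (auto simp: P_def Q_def s)
    then show ?thesis by blast
  qed
  have "P 0 (UNIV, UNIV)" by (simp add: P_def)
  then obtain s where s: "\<And>n. P n (s n)" "\<And>n. Q n (s n) (s (Suc n))"
    using dependent_nat_choice[of P Q] step by blast
  define C where "C n = snd (s n)" for n
  have C: "closed (C n)" "C n \<noteq> {}" for n
    using s(1)[of n] by (auto simp: P_def C_def case_prod_beta)
  have C_Suc: "C (Suc n) \<subseteq> C n" "C (Suc n) \<inter> A n = {}"
    "\<And>x y. x \<in> C (Suc n) \<Longrightarrow> y \<in> C (Suc n) \<Longrightarrow> x - y \<in> U n" for n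
    using s(1)[of n] s(2)[of n] by (auto simp: P_def Q_def C_def case_prod_beta)
  have C_mono: "C m \<subseteq> C n" if "n \<le> m" for m n
    using lift_Suc_antimono_le[of C, OF C_Suc(1) that] .
  obtain X where X: "\<And>n. X n \<in> C n" using C(2) choice[of "\<lambda>n x. x \<in> C n"] by blast
  \<comment> \<open>The tails of \<open>X\<close> lie in arbitrarily small sets, so \<open>X\<close> is Cauchy.\<close>
  have "filterlim (\<lambda>(x, y). x - y) (nhds 0) (filtermap X sequentially \<times>\<^sub>F filtermap X sequentially)"
    unfolding tendsto_def
  proof (intro allI impI)
    fix S :: "'z set" assume "open S" "0 \<in> S"
    then obtain n where n: "U n \<subseteq> S" using U_base by blast
    have ev: "eventually (\<lambda>x. x \<in> C (Suc n)) (filtermap X sequentially)"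
      unfolding eventually_filtermap eventually_sequentially using X C_mono by blast
    show "eventually (\<lambda>p. (case p of (x, y) \<Rightarrow> x - y) \<in> S)
      (filtermap X sequentially \<times>\<^sub>F filtermap X sequentially)"
      unfolding eventually_prod_filter using ev C_Suc(3) n by fastforce
  qed
  then obtain z where "filtermap X sequentially \<le> nhds z"
    using complete[of "filtermap X sequentially"] by (auto simp: filtermap_bot_iff)
  then have lim: "X \<longlonglongrightarrow> z" by (simp add: filterlim_def)
  have "z \<in> C n" for n
  proof (rule Lim_in_closed_set[OF C(1) _ _ lim])
    show "eventually (\<lambda>m. X m \<in> C n) sequentially"
      unfolding eventually_sequentially using X C_mono by blast
  qed simp
  then have "z \<notin> A n" for n using C_Suc(2)[of n] by blast
  then show False using cover by blast
qed

section \<open>The Gelfand integral is a continuous functional\<close>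

lemma tvs_dual_add: "u \<in> tvs_dual smul \<Longrightarrow> u (x + y) = u x + u y"
  unfolding tvs_dual_def Vector_Spaces.linear_def by (auto dest: module_hom.add)

lemma tvs_dual_scale: "u \<in> tvs_dual smul \<Longrightarrow> u (smul c x) = c * u x"
  unfolding tvs_dual_def Vector_Spaces.linear_def by (auto dest: module_hom.scale)

lemma tvs_dual_zero: "u \<in> tvs_dual smul \<Longrightarrow> u 0 = 0"
  using tvs_dual_add[of u smul 0 0] by simp

lemma tvs_dual_tendsto:
  assumes "u \<in> tvs_dual smul" "X \<longlonglongrightarrow> z"
  shows "(\<lambda>n. u (X n)) \<longlonglongrightarrow> u z"
  using assms by (auto simp: tvs_dual_def continuous_on_tendsto_compose)

lemma (in topological_vector_space) tvs_dualI:
  assumes "\<And>x y. u (x + y) = u x + u y" "\<And>c x. u (smul c x) = c * u x" "continuous_on UNIV u"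
  shows "u \<in> tvs_dual smul"
  unfolding tvs_dual_def mem_Collect_eq Vector_Spaces.linear_iff
  using assms vector_space_axioms by (simp add: vector_space_def algebra_simps)

lemma (in topological_vector_space) bounded_near_0_imp_dual:
  assumes add: "\<And>x y. u (x + y) = u x + u y" and scale: "\<And>c x. u (smul c x) = c * u x"
    and V: "open V" "0 \<in> V" and bound: "\<And>v. v \<in> V \<Longrightarrow> norm (u v) \<le> B"
  shows "u \<in> tvs_dual smul"
proof (rule tvs_dualI[OF add scale])
  have u0: "u 0 = 0" using add[of 0 0] by simp
  have B: "0 \<le> B" using bound[OF V(2)] u0 by simp
  have diff: "u (x - y) = u x - u y" for x y using add[of "x - y" y] by simp
  show "continuous_on UNIV u"
    unfolding continuous_on_def
  proof (intro ballI tendstoI)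
    fix x :: 'z and e :: real assume e: "0 < e"
    \<comment> \<open>The denominator \<open>B + 1\<close> gives \<open>norm c * B < e\<close>, also when \<open>B = 0\<close>.\<close>
    define c :: 'f where "c = of_real (e / (B + 1))"
    have c: "c \<noteq> 0" "norm c = e / (B + 1)"
      using e B unfolding c_def norm_of_real of_real_eq_0_iff by auto
    have "continuous_on UNIV (\<lambda>y. (inverse c, y - x))"
      by (intro continuous_on_Pair continuous_on_diff continuous_on_const continuous_on_id)
    then have "continuous_on UNIV (\<lambda>y. smul (inverse c) (y - x))"
      using continuous_on_compose2[OF continuous_smul, of UNIV "\<lambda>y. (inverse c, y - x)"] by simp
    then have "open ((\<lambda>y. smul (inverse c) (y - x)) -` V)"
      using V(1) by (simp add: continuous_on_open_vimage)
    moreover have "x \<in> (\<lambda>y. smul (inverse c) (y - x)) -` V"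
      using V(2) by simp
    ultimately have "eventually (\<lambda>y. y \<in> (\<lambda>y. smul (inverse c) (y - x)) -` V) (at x)"
      by (rule eventually_at_in_open')
    then show "eventually (\<lambda>y. dist (u y) (u x) < e) (at x)"
    proof (rule eventually_mono)
      fix y assume "y \<in> (\<lambda>y. smul (inverse c) (y - x)) -` V"
      then have "norm (inverse c * (u y - u x)) \<le> B"
        using bound[of "smul (inverse c) (y - x)"] by (simp add: scale diff)
      then have "norm c * norm (inverse c * (u y - u x)) \<le> norm c * B"
        by (intro mult_left_mono) auto
      moreover have "norm c * norm (inverse c * (u y - u x)) = norm (u y - u x)"
        using c(1) by (simp flip: norm_mult mult.assoc)
      ultimately have "norm (u y - u x) \<le> e / (B + 1) * B" using c(2) by simp
      also have "\<dots> < e" using e B by (simp add: field_simps)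
      finally show "dist (u y) (u x) < e" by (simp add: dist_norm)
    qed
  qed
qed

text \<open>
  The seminorm takes values in the extended nonnegative reals, so that Fatou's lemma applies
  without integrability.
\<close>

lemma closed_gelfand_sublevel:
  fixes smul :: "'f::real_or_complex \<Rightarrow> 'z::topological_ab_group_add \<Rightarrow> 'z"
  assumes metrizable: "metrizable_space (euclidean :: 'z topology)"
    and \<psi>: "gelfand_integrable smul M \<psi>"
  shows "closed {z. (\<integral>\<^sup>+x. ennreal (norm (\<psi> x z)) \<partial>M) \<le> b}"
proof -
  let ?p = "\<lambda>z. \<integral>\<^sup>+x. ennreal (norm (\<psi> x z)) \<partial>M"
  have dual: "\<And>x. x \<in> space M \<Longrightarrow> \<psi> x \<in> tvs_dual smul"
    and int: "\<And>z. integrable M (\<lambda>x. \<psi> x z)"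
    using \<psi> by (auto simp: gelfand_integrable_def)
  have measurable: "(\<lambda>x. ennreal (norm (\<psi> x z))) \<in> borel_measurable M" for z
    using int by (intro measurable_compose[OF _ measurable_ennreal]
        measurable_compose[OF borel_measurable_integrable borel_measurable_norm])
  obtain S d where "Metric_space S d" and top: "(euclidean :: 'z topology) = Metric_space.mtopology S d"
    using metrizable unfolding metrizable_space_def by blast
  then interpret Metric_space S d by simp
  have S: "S = UNIV" using arg_cong[OF top, of topspace] by simp
  have "?p z \<le> b" if X: "\<And>n. ?p (X n) \<le> b" and lim: "X \<longlonglongrightarrow> z" for X z
  proof -
    have "?p z = (\<integral>\<^sup>+x. liminf (\<lambda>n. ennreal (norm (\<psi> x (X n)))) \<partial>M)"
    proof (rule nn_integral_cong)
      fix x assume "x \<in> space M"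
      then have "(\<lambda>n. ennreal (norm (\<psi> x (X n)))) \<longlonglongrightarrow> ennreal (norm (\<psi> x z))"
        using tvs_dual_tendsto[OF dual lim] by (intro tendsto_ennrealI tendsto_norm)
      then show "ennreal (norm (\<psi> x z)) = liminf (\<lambda>n. ennreal (norm (\<psi> x (X n))))"
        by (simp add: lim_imp_Liminf[symmetric])
    qed
    also have "\<dots> \<le> liminf (\<lambda>n. ?p (X n))"
      using measurable by (rule nn_integral_liminf)
    also have "\<dots> \<le> liminf (\<lambda>n. b)"
      using X by (intro Liminf_mono) simp
    finally show ?thesis by (simp add: Liminf_const)
  qed
  then have "closedin mtopology {z. ?p z \<le> b}"
    unfolding metric_closedin_iff_sequentially_closed
    unfolding top[symmetric] limitin_canonical_iff
    by (auto simp: S image_subset_iff)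
  then show ?thesis unfolding top[symmetric] by simp
qed

lemma (in frechet_space) gelfand_integral_in_dual:
  assumes \<psi>: "gelfand_integrable smul M \<psi>" and E: "E \<in> sets M"
  shows "gelfand_integral M E \<psi> \<in> tvs_dual smul"
proof -
  let ?p = "\<lambda>z. \<integral>\<^sup>+x. ennreal (norm (\<psi> x z)) \<partial>M"
  let ?I = "gelfand_integral M E \<psi>"
  have dual: "\<And>x. x \<in> space M \<Longrightarrow> \<psi> x \<in> tvs_dual smul"
    and int: "\<And>z. integrable M (\<lambda>x. \<psi> x z)"
    using \<psi> by (auto simp: gelfand_integrable_def)
  have measurable: "(\<lambda>x. ennreal (norm (\<psi> x z))) \<in> borel_measurable M" for z
    using int by (intro measurable_compose[OF _ measurable_ennreal]
        measurable_compose[OF borel_measurable_integrable borel_measurable_norm])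
  have setint: "set_integrable M E (\<lambda>x. \<psi> x z)" for z
    unfolding set_integrable_def using integrable_mult_indicator[OF E int] .
  have cong: "(LINT x:E|M. f x) = (LINT x:E|M. g x)" if "\<And>x. x \<in> space M \<Longrightarrow> f x = g x"
    for f g :: "_ \<Rightarrow> 'f"
    using that unfolding set_lebesgue_integral_def by (intro Bochner_Integration.integral_cong) auto
  have p_diff: "?p v \<le> ?p (a + v) + ?p a" for a v
  proof -
    have "?p v \<le> (\<integral>\<^sup>+x. ennreal (norm (\<psi> x (a + v))) + ennreal (norm (\<psi> x a)) \<partial>M)"
    proof (rule nn_integral_mono)
      fix x assume "x \<in> space M"
      then have "\<psi> x v = \<psi> x (a + v) - \<psi> x a" by (simp add: tvs_dual_add[OF dual])
      then have "norm (\<psi> x v) \<le> norm (\<psi> x (a + v)) + norm (\<psi> x a)"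
        using norm_triangle_ineq4 by metis
      then show "ennreal (norm (\<psi> x v)) \<le> ennreal (norm (\<psi> x (a + v))) + ennreal (norm (\<psi> x a))"
        by (simp flip: ennreal_plus)
    qed
    also have "\<dots> = ?p (a + v) + ?p a"
      using measurable measurable by (rule nn_integral_add)
    finally show ?thesis .
  qed
  have "\<exists>n::nat. ?p z \<le> of_nat n" for z
  proof -
    have "?p z < \<infinity>" using int[of z] by (simp add: integrable_iff_bounded)
    then obtain r where r: "0 \<le> r" "?p z = ennreal r"
      by (cases "?p z") auto
    obtain n where "r \<le> of_nat n" using real_arch_simple by blast
    then show ?thesis using r by (auto simp: ennreal_of_nat_eq_real_of_nat
          intro!: exI[of _ n] ennreal_leI)
  qed
  then have "(\<Union>n::nat. {z. ?p z \<le> of_nat n}) = UNIV" by blast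
  then obtain n :: nat where "interior {z. ?p z \<le> of_nat n} \<noteq> {}"
    using complete_group_Baire[OF metrizable complete, of "\<lambda>n. {z. ?p z \<le> of_nat n}"]
      closed_gelfand_sublevel[OF metrizable \<psi>] by auto
  then obtain a where a: "a \<in> interior {z. ?p z \<le> of_nat n}" by blast
  define V where "V = (\<lambda>v. a + v) -` interior {z. ?p z \<le> of_nat n}"
  have "open V"
    unfolding V_def by (intro open_vimage continuous_intros) auto
  have "0 \<in> V" using a by (simp add: V_def)
  show ?thesis
  proof (rule bounded_near_0_imp_dual[OF _ _ \<open>open V\<close> \<open>0 \<in> V\<close>])
    show "?I (x + y) = ?I x + ?I y" for x y
    proof -
      have "?I (x + y) = (LINT t:E|M. \<psi> t x + \<psi> t y)"
        unfolding gelfand_integral_def by (intro cong) (simp add: tvs_dual_add[OF dual])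
      then show ?thesis
        by (simp add: gelfand_integral_def set_integral_add[OF setint setint])
    qed
    show "?I (smul c x) = c * ?I x" for c x
    proof -
      have "?I (smul c x) = (LINT t:E|M. c * \<psi> t x)"
        unfolding gelfand_integral_def by (intro cong) (simp add: tvs_dual_scale[OF dual])
      then show ?thesis by (simp add: gelfand_integral_def)
    qed
    fix v assume "v \<in> V"
    then have "?p (a + v) \<le> of_nat n" "?p a \<le> of_nat n"
      using a interior_subset unfolding V_def by blast+
    then have pv: "?p v \<le> of_nat n + of_nat n"
      using p_diff[of v a] by (meson add_mono order_trans)
    have "ennreal (norm (?I v)) \<le> (\<integral>\<^sup>+x. ennreal (norm (indicator E x *\<^sub>R \<psi> x v)) \<partial>M)"
      unfolding gelfand_integral_def set_lebesgue_integral_def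
      by (rule integral_norm_bound_ennreal) (use setint in \<open>simp add: set_integrable_def\<close>)
    also have "\<dots> \<le> ?p v"
      by (intro nn_integral_mono) (auto simp: indicator_def)
    also note pv
    also have "of_nat n + of_nat n = ennreal (real (n + n))"
      by (simp add: ennreal_of_nat_eq_real_of_nat flip: ennreal_plus)
    finally show "norm (?I v) \<le> real (n + n)" by (simp add: ennreal_le_iff)
  qed
qed

section \<open>Weak star continuous functionals are evaluations\<close>

text \<open>Weak star open sets constrain only finitely many coordinates near each of their points.\<close>

lemma weak_star_open_finite:
  assumes "openin (weak_star smul) W" "u \<in> W"
  shows "\<exists>S. finite S \<and> (\<forall>v\<in>tvs_dual smul. (\<forall>z\<in>S. v z = u z) \<longrightarrow> v \<in> W)"
proof -
  have "generate_topology_on {{u \<in> tvs_dual smul. u z \<in> V} | z V. open V} W"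
    using assms(1) by (simp add: weak_star_def openin_topology_generated_by_iff)
  then show ?thesis using assms(2)
  proof (induction arbitrary: u)
    case Empty
    then show ?case by simp
  next
    case (Int a b)
    have u: "u \<in> a" "u \<in> b" using Int.prems by auto
    obtain S where "finite S" "\<forall>v\<in>tvs_dual smul. (\<forall>z\<in>S. v z = u z) \<longrightarrow> v \<in> a"
      using Int.IH(1)[OF u(1)] by blast
    moreover obtain S' where "finite S'" "\<forall>v\<in>tvs_dual smul. (\<forall>z\<in>S'. v z = u z) \<longrightarrow> v \<in> b"
      using Int.IH(2)[OF u(2)] by blast
    ultimately show ?case by (intro exI[of _ "S \<union> S'"]) auto
  next
    case (UN K)
    from UN.prems obtain k where k: "k \<in> K" "u \<in> k" by blast
    show ?case using UN.IH[OF k] k(1) by blast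
  next
    case (Basis s)
    then obtain z V where "s = {u \<in> tvs_dual smul. u z \<in> V}" by blast
    then show ?case using Basis by (intro exI[of _ "{z}"]) auto
  qed
qed

context topological_vector_space
begin

lemma dual_zero: "(\<lambda>_. 0) \<in> tvs_dual smul"
  by (rule tvs_dualI) auto

lemma dual_add:
  assumes "u \<in> tvs_dual smul" "v \<in> tvs_dual smul"
  shows "(\<lambda>z. u z + v z) \<in> tvs_dual smul"
proof (rule tvs_dualI)
  show "continuous_on UNIV (\<lambda>z. u z + v z)"
    using assms by (intro continuous_on_add) (auto simp: tvs_dual_def)
qed (simp_all add: assms[THEN tvs_dual_add] assms[THEN tvs_dual_scale] algebra_simps)

lemma dual_scale:
  assumes "u \<in> tvs_dual smul"
  shows "(\<lambda>z. c * u z) \<in> tvs_dual smul"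
proof (rule tvs_dualI)
  show "continuous_on UNIV (\<lambda>z. c * u z)"
    using assms by (intro continuous_on_mult continuous_on_const) (auto simp: tvs_dual_def)
qed (simp_all add: assms[THEN tvs_dual_add] assms[THEN tvs_dual_scale] algebra_simps)

text \<open>
  The linear functional \<open>\<phi>\<close> lives on the dual. If it vanishes on the common kernel of finitely many
  evaluations, then it is a linear combination of them, hence itself an evaluation.
\<close>

lemma functional_vanishing_on_kernels:
  assumes "finite S"
    and "\<And>u v. u \<in> tvs_dual smul \<Longrightarrow> v \<in> tvs_dual smul \<Longrightarrow> \<phi> (\<lambda>z. u z + v z) = \<phi> u + \<phi> v"
    and "\<And>c u. u \<in> tvs_dual smul \<Longrightarrow> \<phi> (\<lambda>z. c * u z) = c * \<phi> u"
    and "\<And>u. u \<in> tvs_dual smul \<Longrightarrow> \<forall>z\<in>S. u z = 0 \<Longrightarrow> \<phi> u = 0"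
  shows "\<exists>w. \<forall>u\<in>tvs_dual smul. \<phi> u = u w"
  using assms
proof (induction S arbitrary: \<phi> rule: finite_induct)
  case empty
  then show ?case by (intro exI[of _ 0]) (simp add: tvs_dual_zero)
next
  case (insert a S)
  show ?case
  proof (cases "\<forall>u\<in>tvs_dual smul. (\<forall>z\<in>S. u z = 0) \<longrightarrow> u a = 0")
    case True
    then show ?thesis using insert.prems by (intro insert.IH) auto
  next
    case False
    then obtain u1 where u1: "u1 \<in> tvs_dual smul" "\<forall>z\<in>S. u1 z = 0" "u1 a \<noteq> 0" by blast
    define u0 where "u0 = (\<lambda>z. inverse (u1 a) * u1 z)"
    have u0: "u0 \<in> tvs_dual smul" "\<forall>z\<in>S. u0 z = 0" "u0 a = 1"
      using u1 dual_scale by (auto simp: u0_def)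
    have "\<exists>w. \<forall>u\<in>tvs_dual smul. \<phi> u - u a * \<phi> u0 = u w"
    proof (rule insert.IH)
      fix u assume u: "u \<in> tvs_dual smul" "\<forall>z\<in>S. u z = 0"
      \<comment> \<open>Subtracting \<open>u a\<close> times \<open>u0\<close> makes \<open>u\<close> vanish at \<open>a\<close> as well.\<close>
      have "\<phi> (\<lambda>z. u z + (- u a) * u0 z) = 0"
        using u u0 dual_scale[OF u0(1), of "- u a"] by (intro insert.prems(3) dual_add) auto
      moreover have "\<phi> (\<lambda>z. u z + (- u a) * u0 z) = \<phi> u + (- u a) * \<phi> u0"
        using insert.prems(1)[OF u(1) dual_scale[OF u0(1), of "- u a"]]
          insert.prems(2)[OF u0(1), of "- u a"] by simp
      ultimately show "\<phi> u - u a * \<phi> u0 = 0" by simp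
    qed (simp_all add: insert.prems algebra_simps)
    then obtain w where w: "\<And>u. u \<in> tvs_dual smul \<Longrightarrow> \<phi> u - u a * \<phi> u0 = u w" by blast
    have "\<phi> u = u (w + smul (\<phi> u0) a)" if "u \<in> tvs_dual smul" for u
      using w[OF that] that by (simp add: tvs_dual_add tvs_dual_scale algebra_simps)
    then show ?thesis by blast
  qed
qed

lemma weak_star_continuous_functional_is_evaluation:
  assumes add: "\<And>u v. u \<in> tvs_dual smul \<Longrightarrow> v \<in> tvs_dual smul \<Longrightarrow> \<phi> (\<lambda>z. u z + v z) = \<phi> u + \<phi> v"
    and scale: "\<And>c u. u \<in> tvs_dual smul \<Longrightarrow> \<phi> (\<lambda>z. c * u z) = c * \<phi> u"
    and cont: "continuous_map (weak_star smul) euclidean \<phi>"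
  shows "\<exists>w. \<forall>u\<in>tvs_dual smul. \<phi> u = u w"
proof -
  define W where "W = {u \<in> topspace (weak_star smul). \<phi> u \<in> ball 0 1}"
  have W: "openin (weak_star smul) W"
    unfolding W_def using cont by (rule openin_continuous_map_preimage) simp
  have "\<phi> (\<lambda>_. 0) = 0" using scale[OF dual_zero, of 0] by simp
  then have "(\<lambda>_. 0) \<in> W" by (simp add: W_def topspace_weak_star dual_zero)
  then obtain S where S: "finite S" "\<And>v. v \<in> tvs_dual smul \<Longrightarrow> \<forall>z\<in>S. v z = 0 \<Longrightarrow> v \<in> W"
    using weak_star_open_finite[OF W, of "\<lambda>_. 0"] by metis
  show ?thesis
  proof (rule functional_vanishing_on_kernels[OF S(1) add scale])
    fix u assume u: "u \<in> tvs_dual smul" "\<forall>z\<in>S. u z = 0"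
    show "\<phi> u = 0"
    proof (rule ccontr)
      assume nz: "\<phi> u \<noteq> 0"
      \<comment> \<open>The common kernel is a subspace, so \<open>u\<close> can be rescaled to leave the unit ball.\<close>
      have "(\<lambda>z. inverse (\<phi> u) * u z) \<in> W"
        using u by (intro S(2) dual_scale) auto
      then show False using nz scale[OF u(1), of "inverse (\<phi> u)"] by (simp add: W_def)
    qed
  qed
qed

end

lemma continuous_map_weak_star_evaluation:
  "continuous_map (weak_star smul) euclidean (\<lambda>u. u z)"
proof -
  have "openin (weak_star smul) {u \<in> tvs_dual smul. u z \<in> V}" if "open V" for V
    unfolding weak_star_def using that by (intro topology_generated_by_Basis) blast
  then show ?thesis by (simp add: continuous_map_def topspace_weak_star)
qed

section \<open>Weak star continuous maps commute with the Gelfand integral\<close>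

theorem proposition3p12:
  fixes M :: "'m measure"
    and smulZ :: "'f::real_or_complex \<Rightarrow> 'z::topological_ab_group_add \<Rightarrow> 'z"
    and smulG :: "'f \<Rightarrow> 'g::topological_ab_group_add \<Rightarrow> 'g"
    and \<psi> :: "'m \<Rightarrow> 'z \<Rightarrow> 'f"
    and T :: "('z \<Rightarrow> 'f) \<Rightarrow> ('g \<Rightarrow> 'f)"
  assumes "sigma_finite_measure M"
    and "frechet_space smulZ"
    and "frechet_space smulG"
    and "gelfand_integrable smulZ M \<psi>"
    and "dual_linear smulZ smulG T"
    and "continuous_map (weak_star smulZ) (weak_star smulG) T"
  shows "gelfand_integrable smulG M (\<lambda>x. T (\<psi> x)) \<and>
    (\<forall>E\<in>sets M.
      gelfand_integral M E (\<lambda>x. T (\<psi> x)) \<in> tvs_dual smulG \<and>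
      T (gelfand_integral M E \<psi>) = gelfand_integral M E (\<lambda>x. T (\<psi> x)))"
proof -
  interpret Z: frechet_space smulZ by fact
  have dual: "\<And>x. x \<in> space M \<Longrightarrow> \<psi> x \<in> tvs_dual smulZ"
    and int: "\<And>z. integrable M (\<lambda>x. \<psi> x z)"
    using assms(4) by (auto simp: gelfand_integrable_def)
  have T_dual: "\<And>u. u \<in> tvs_dual smulZ \<Longrightarrow> T u \<in> tvs_dual smulG"
    using assms(5) by (auto simp: dual_linear_def)
  have "\<exists>w. \<forall>u\<in>tvs_dual smulZ. T u g = u w" for g
  proof (rule Z.weak_star_continuous_functional_is_evaluation)
    show "continuous_map (weak_star smulZ) euclidean (\<lambda>u. T u g)"
      using continuous_map_compose[OF assms(6) continuous_map_weak_star_evaluation]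
      by (simp add: o_def)
  qed (use assms(5) in \<open>simp_all add: dual_linear_def\<close>)
  then obtain w where w: "\<And>u g. u \<in> tvs_dual smulZ \<Longrightarrow> T u g = u (w g)" by metis
  have "integrable M (\<lambda>x. T (\<psi> x) g)" for g
    using int[of "w g"] by (rule Bochner_Integration.integrable_cong[THEN iffD1, rotated -1])
      (auto simp: w dual)
  then have "gelfand_integrable smulG M (\<lambda>x. T (\<psi> x))"
    using T_dual dual by (simp add: gelfand_integrable_def)
  moreover have "T (gelfand_integral M E \<psi>) = gelfand_integral M E (\<lambda>x. T (\<psi> x))"
    if E: "E \<in> sets M" for E
  proof
    fix g
    have "T (gelfand_integral M E \<psi>) g = (LINT x:E|M. \<psi> x (w g))"
      unfolding w[OF Z.gelfand_integral_in_dual[OF assms(4) E]] by (simp add: gelfand_integral_def)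
    also have "\<dots> = (LINT x:E|M. T (\<psi> x) g)"
      unfolding set_lebesgue_integral_def
      by (intro Bochner_Integration.integral_cong) (auto simp: w dual)
    finally show "T (gelfand_integral M E \<psi>) g = gelfand_integral M E (\<lambda>x. T (\<psi> x)) g"
      by (simp add: gelfand_integral_def)
  qed
  ultimately show ?thesis
    using T_dual[OF Z.gelfand_integral_in_dual[OF assms(4)]] by simp
qed

end
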